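(* For any mm-space $X$ and any real numbers $\kappa\in(0,1)$ and $R>0$, $$\min\{R,\operatorname{ObsDiam}(X;-\kappa)\}\le\operatorname{ObsDiam}\!\left(X,\left[-\frac{R}{1-\kappa},\frac{R}{1-\kappa}\right];-\kappa\right).$$
   Context: An mm-space is a triple $(X,d_X,\mu_X)$ (written $X$) where $d_X$ is a complete separable metric on $X$ and $\mu_X$ is a Borel probability measure on $(X,d_X)$ with full support. For metric spaces $X,Y$, $\operatorname{Lip}_1(X,Y)$ is the set of 1-Lipschitz maps $f\colon X\to Y$, i.e. $d_Y(f(x),f(y))\le d_X(x,y)$ for all $x,y\in X$. For a Borel probability measure $\mu$ on a metric space $Y$ and a real number $\alpha\le 1$, $\operatorname{PartDiam}(\mu;\alpha)$ is the infimum of the diameters of all Borel subsets $A\subset Y$ with $\mu(A)\ge\alpha$. For an mm-space $X$, a metric space $Y$ and $\kappa\ge 0$, the observable diameter with screen $Y$ is $$\operatorname{ObsDiam}(X,Y;-\kappa)=\sup\{\operatorname{PartDiam}(f_*\mu_X;1-\kappa)\mid f\in\operatorname{Lip}_1(X,Y)\},$$ where $f_*\mu_X$ is the push-forward, and $\operatorname{ObsDiam}(X;-\kappa)=\operatorname{ObsDiam}(X,\mathbb{R};-\kappa)\in[0,\infty]$. Intervals carry the Euclidean metric. *)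

theory Defs
  imports "HOL-Probability.Probability"
begin

text \<open>
  The metric of an mm-space is that of its type: the class \<open>polish_space\<close> consists of the
  complete metric spaces with a countable base, i.e. the complete separable ones.
\<close>

locale mm_space = prob_space M for M :: "'a::polish_space measure" +
  assumes sets_eq_borel: "sets M = sets borel"
    and full_support: "open U \<Longrightarrow> U \<noteq> {} \<Longrightarrow> emeasure M U > 0"

text \<open>
  The extended diameter; the library's \<open>diameter\<close> is real-valued and meaningless on unbounded
  sets.  The empty set has diameter 0.
\<close>

definition ediam :: "'b::metric_space set \<Rightarrow> ennreal" where
  "ediam A = (SUP x\<in>A. SUP y\<in>A. ennreal (dist x y))"

definition PartDiam :: "'b::metric_space measure \<Rightarrow> real \<Rightarrow> ennreal" where
  "PartDiam \<mu> \<alpha> = (INF A\<in>{A \<in> sets \<mu>. measure \<mu> A \<ge> \<alpha>}. ediam A)"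

text \<open>
  A metric space \<open>Y\<close> is given as a subset of a metric type, with the restricted metric.
\<close>

definition Lip1 :: "'a::metric_space set \<Rightarrow> 'b::metric_space set \<Rightarrow> ('a \<Rightarrow> 'b) set" where
  "Lip1 X Y = {f \<in> X \<rightarrow> Y. 1-lipschitz_on X f}"

text \<open>
  \<open>ObsDiam_screen M Y \<kappa>\<close> stands for $\mathrm{ObsDiam}(X,Y;-\kappa)$.  The push-forward is taken
  as a Borel measure on the subspace \<open>Y\<close>, so that only Borel subsets of \<open>Y\<close> compete in
  \<^const>\<open>PartDiam\<close>.
\<close>

definition ObsDiam_screen :: "'a::polish_space measure \<Rightarrow> 'b::metric_space set \<Rightarrow> real \<Rightarrow> ennreal" where
  "ObsDiam_screen M Y \<kappa> =
     (SUP f\<in>Lip1 UNIV Y. PartDiam (distr M (restrict_space borel Y) f) (1 - \<kappa>))"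

definition ObsDiam :: "'a::polish_space measure \<Rightarrow> real \<Rightarrow> ennreal" where
  "ObsDiam M \<kappa> = ObsDiam_screen M (UNIV :: real set) \<kappa>"

end

theory Submission
  imports Defs
begin

text \<open>
  Put \<open>m = 1 - \<kappa>\<close>. Given a 1-Lipschitz \<open>f\<close> into the line with image measure \<open>\<nu>\<close>, it
  suffices to compress the line, by a monotone 1-Lipschitz \<open>h\<close>, into an interval of length
  \<open>2 * R / m\<close> such that every set of \<open>\<nu>\<close>-mass at least \<open>m\<close> keeps its diameter up to the
  cutoff \<open>R\<close>. Since a set of mass \<open>m\<close> in the image of \<open>h \<circ> f\<close> has a preimage under \<open>h\<close> of
  diameter at least the partial diameter of \<open>\<nu>\<close>, the inequality then follows for each \<open>f\<close>.

  The point is that such sets cannot be spread everywhere: at most \<open>1 / m\<close> points, namely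
  suitable quantiles of \<open>\<nu>\<close>, pierce the convex hull of all of them, up to closure
  (\<open>piercing_points\<close>). So \<open>h\<close> only needs slope one within distance \<open>R\<close> of
  these points and may be constant elsewhere (\<open>slope_one_near_points\<close>). Each point uses up
  length \<open>2 * R\<close>, at most the length of the screen in total, and an interval \<open>[u, v]\<close>
  around one of the points is mapped to one of length at least \<open>min R (v - u)\<close>.
\<close>

lemma (in real_distribution) quantile_exists:
  assumes "0 < t" "t < 1"
  obtains q where "t \<le> cdf M q" "\<And>z. z < q \<Longrightarrow> cdf M z < t"
proof
  define Q where "Q = {x. t \<le> cdf M x}"
  have "eventually (\<lambda>x. t < cdf M x) at_top"
    using order_tendstoD(1)[OF cdf_lim_at_top_prob] assms by blast
  then have ne: "Q \<noteq> {}"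
    by (auto simp: Q_def eventually_at_top_linorder intro: less_imp_le)
  have "eventually (\<lambda>x. cdf M x < t) at_bot"
    using order_tendstoD(2)[OF cdf_lim_at_bot] assms by blast
  then obtain N where N: "\<And>x. x \<le> N \<Longrightarrow> cdf M x < t"
    by (auto simp: eventually_at_bot_linorder)
  have bdd: "bdd_below Q"
    using N by (intro bdd_belowI[of _ N]) (auto simp: Q_def not_less[symmetric] dest: less_imp_le)
  show "cdf M z < t" if "z < Inf Q" for z
    using cInf_lower[OF _ bdd, of z] that by (force simp: Q_def)
  have "eventually (\<lambda>x. t \<le> cdf M x) (at_right (Inf Q))"
    unfolding eventually_at_right_field
  proof (intro exI[of _ "Inf Q + 1"] conjI allI impI)
    fix y assume "Inf Q < y"
    then obtain x where "x \<in> Q" "x < y"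
      using ne bdd by (auto simp: cInf_less_iff)
    then show "t \<le> cdf M y"
      using cdf_nondecreasing[of x y] by (simp add: Q_def)
  qed simp
  then show "t \<le> cdf M (Inf Q)"
    using cdf_is_right_cont[of "Inf Q"]
    by (intro tendsto_lowerbound[of "cdf M" _ "at_right (Inf Q)"])
       (auto simp: continuous_within)
qed

text \<open>
  The last two clauses place the point in the closed convex hull of \<open>B\<close>, also when
  \<open>B\<close> is unbounded. If \<open>a\<close> is the mass to the left of \<open>B\<close>, then the hull of \<open>B\<close> carries the
  levels of the distribution function between \<open>a\<close> and \<open>a + m\<close>, so its closure contains the
  quantile of any level in \<open>(a, a + m]\<close> below 1. The
  levels must therefore meet every such interval with \<open>0 \<le> a \<le> 1 - m\<close>; the positive multiples of \<open>m\<close> up to \<open>1\<close> do.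
\<close>

lemma (in real_distribution) piercing_points:
  fixes m :: real
  assumes m: "0 < m" "m \<le> 1"
  obtains S :: "real set" where "finite S" "card S * m \<le> 1"
    "\<And>B. B \<in> sets borel \<Longrightarrow> m \<le> measure M B \<Longrightarrow>
       \<exists>q\<in>S. (\<exists>b\<in>B. b \<le> q) \<and> (\<forall>z<q. \<exists>b\<in>B. z < b)"
proof -
  define n where "n = nat \<lfloor>1 / m\<rfloor>"
  \<comment> \<open>The level 1 need not have a quantile: \<open>B\<close> may be unbounded above. The cap keeps the levels
    below 1, and stays above \<open>1 - m\<close>, hence in the intervals whose multiple of \<open>m\<close> it replaces.\<close>
  define t where "t k = min (real k * m) (1 - m / 2)" for k :: nat
  have "0 < t k \<and> t k < 1" if "k \<ge> 1" for k
    using m that by (auto simp: t_def)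
  then have "\<exists>q. t k \<le> cdf M q \<and> (\<forall>z<q. cdf M z < t k)" if "k \<ge> 1" for k
    using quantile_exists[of "t k"] that by metis
  then obtain q where q: "\<And>k. k \<ge> 1 \<Longrightarrow> t k \<le> cdf M (q k)"
      "\<And>k z. k \<ge> 1 \<Longrightarrow> z < q k \<Longrightarrow> cdf M z < t k"
    by metis
  show thesis
  proof
    show "finite (q ` {1..n})" by simp
    have "card (q ` {1..n}) \<le> n"
      using card_image_le[of "{1..n}" q] by simp
    moreover have "real n \<le> 1 / m"
      using m by (simp add: n_def)
    ultimately have "card (q ` {1..n}) \<le> 1 / m" by linarith
    then show "card (q ` {1..n}) * m \<le> 1"
      using m by (simp add: field_simps)
  next
    fix B :: "real set" assume B: "B \<in> sets borel" "m \<le> measure M B"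
    define L where "L = {z. \<forall>b\<in>B. z < b}"
    define P where "P = {z. \<exists>b\<in>B. z \<le> b}"
    have "is_interval L" "is_interval P"
      unfolding L_def P_def is_interval_1 by (blast intro: order.trans order.strict_trans1)+
    then have LP[measurable]: "L \<in> sets borel" "P \<in> sets borel"
      by (auto intro: real_interval_borel_measurable)
    note [measurable] = B(1)
    have disj: "L \<inter> B = {}" by (auto simp: L_def)
    have sum: "measure M (L \<union> B) = measure M L + measure M B"
      using disj by (intro finite_measure_Union) (auto simp: LP B)
    have upper: "measure M L + m \<le> 1"
      using sum B(2) prob_le_1[of "L \<union> B"] by linarith
    have "B \<noteq> {}" using B(2) m by auto
    then have "L \<union> B \<subseteq> P"
      by (force simp: L_def P_def)
    then have "measure M (L \<union> B) \<le> measure M P"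
      by (intro finite_measure_mono) (auto simp: LP)
    then have P: "measure M L + m \<le> measure M P"
      using sum B(2) by linarith
    define k where "k = nat (\<lfloor>measure M L / m\<rfloor> + 1)"
    have rk: "real k = of_int \<lfloor>measure M L / m\<rfloor> + 1"
      using m by (simp add: k_def)
    have "measure M L / m < real k" "real k \<le> measure M L / m + 1"
      unfolding rk by linarith+
    then have k: "measure M L < k * m" "k * m \<le> measure M L + m"
      using m by (auto simp: field_simps)
    have k1: "k \<ge> 1"
      using k(1) measure_nonneg[of M L] by (cases k) auto
    have "k * m \<le> 1" using k upper by linarith
    then have "real k \<le> 1 / m" using m by (simp add: field_simps)
    then have kn: "k \<le> n" unfolding n_def using le_nat_floor by blast
    have t: "measure M L < t k" "t k \<le> measure M P"
      using k upper P m by (auto simp: t_def)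
    have low: "\<exists>b\<in>B. b \<le> q k"
    proof (rule ccontr)
      assume "\<not> ?thesis"
      then have "{..q k} \<subseteq> L" by (force simp: L_def)
      then have "cdf M (q k) \<le> measure M L"
        unfolding cdf_def by (intro finite_measure_mono) (auto simp: LP)
      then show False using q(1)[OF k1] t(1) by linarith
    qed
    have up: "\<exists>b\<in>B. z < b" if "z < q k" for z
    proof (rule ccontr)
      assume "\<not> ?thesis"
      then have "P \<subseteq> {..z}" by (force simp: P_def)
      then have "measure M P \<le> cdf M z"
        unfolding cdf_def by (intro finite_measure_mono) auto
      then show False using q(2)[OF k1 that] t(2) by linarith
    qed
    show "\<exists>p\<in>q ` {1..n}. (\<exists>b\<in>B. b \<le> p) \<and> (\<forall>z<p. \<exists>b\<in>B. z < b)"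
      using low up k1 kn by auto
  qed
qed

text \<open>
  Take for \<open>h\<close> a primitive of the indicator function of the union of the intervals
  \<open>[q - R, q + R]\<close>, shifted to be centred. The difference on the left below is the signed
  length of the intersection of \<open>[u, v]\<close> with one of these intervals.
\<close>

lemma slope_one_near_points:
  fixes S :: "real set" and R :: real
  assumes "finite S" "0 < R"
  obtains h :: "real \<Rightarrow> real" where
    "\<And>x. \<bar>h x\<bar> \<le> card S * R"
    "1-lipschitz_on UNIV h"
    "\<And>q u v. q \<in> S \<Longrightarrow> u \<le> v \<Longrightarrow> min v (q + R) - max u (q - R) \<le> h v - h u"
proof -
  define U where "U = (\<Union>q\<in>S. {q - R..q + R})"
  have U: "U \<in> fmeasurable lborel"
    unfolding U_def using assms by (intro fmeasurable.finite_UN) (auto simp: fmeasurable_def)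
  define h where "h x = measure lborel (U \<inter> {..x}) - card S * R" for x
  have fm: "U \<inter> J \<in> fmeasurable lborel" if "J \<in> sets borel" for J
    using U that by (intro fmeasurable_Int_fmeasurable) auto
  have diff: "h v - h u = measure lborel (U \<inter> {u<..v})" if "u \<le> v" for u v
  proof -
    have "({..u} \<inter> {u<..v}) = {}" by auto
    then have "(U \<inter> {..u}) \<inter> (U \<inter> {u<..v}) = {}" by blast
    moreover have "U \<inter> {..v} = (U \<inter> {..u}) \<union> (U \<inter> {u<..v})" using that by auto
    ultimately have "measure lborel (U \<inter> {..v})
        = measure lborel (U \<inter> {..u}) + measure lborel (U \<inter> {u<..v})"
      using measure_Un3[OF fm[of "{..u}"] fm[of "{u<..v}"]]
      by simp
    then show ?thesis by (simp add: h_def)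
  qed
  have "measure lborel U \<le> (\<Sum>q\<in>S. measure lborel {q - R..q + R})"
    unfolding U_def using assms by (intro measure_UNION_le) auto
  also have "\<dots> = 2 * (card S * R)" using assms by simp
  finally have U_le: "measure lborel U \<le> 2 * (card S * R)" .
  show thesis
  proof
    fix x
    have "measure lborel (U \<inter> {..x}) \<le> measure lborel U"
      using U fm by (intro measure_mono_fmeasurable) (auto intro: fmeasurableD)
    then show "\<bar>h x\<bar> \<le> card S * R"
      using U_le measure_nonneg[of lborel "U \<inter> {..x}"] unfolding h_def by linarith
  next
    have *: "\<bar>h v - h u\<bar> \<le> v - u" if "u \<le> v" for u v
    proof -
      have "measure lborel (U \<inter> {u<..v}) \<le> measure lborel {u<..v}"
        using fm[of "{u<..v}"] that
        by (intro measure_mono_fmeasurable) (auto intro: fmeasurableD simp: fmeasurable_def)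
      then show ?thesis using that by (simp add: diff)
    qed
    show "1-lipschitz_on UNIV h"
    proof (rule lipschitz_onI)
      fix x y :: real
      show "dist (h x) (h y) \<le> 1 * dist x y"
        using *[of x y] *[of y x] by (cases "x \<le> y") (auto simp: dist_real_def)
    qed simp
  next
    fix q u v :: real assume "q \<in> S" "u \<le> v"
    let ?a = "max u (q - R)" and ?b = "min v (q + R)"
    have "measure lborel {?a<..?b} \<le> measure lborel (U \<inter> {u<..v})"
      using \<open>q \<in> S\<close> fm[of "{u<..v}"]
      by (intro measure_mono_fmeasurable) (auto simp: U_def)
    moreover have "?b - ?a \<le> measure lborel {?a<..?b}"
      by (cases "?a \<le> ?b") auto
    ultimately show "?b - ?a \<le> h v - h u"
      using diff[OF \<open>u \<le> v\<close>] by linarith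
  qed
qed

text \<open>
  Diameters are compared through pairs: a pair in \<open>B = h -` A\<close> that almost realises the
  diameter of \<open>B\<close> is widened, still within \<open>B\<close>, until it (nearly) surrounds a piercing point;
  there \<open>h\<close> has slope one.
\<close>

lemma PartDiam_screen_ge:
  fixes M :: "'a::polish_space measure" and f :: "'a \<Rightarrow> real" and m R :: real
  assumes "mm_space M" "0 < m" "m \<le> 1" "0 < R" and f: "1-lipschitz_on UNIV f"
  obtains g where "g \<in> Lip1 UNIV {- (R / m) .. R / m}"
    "min (ennreal R) (PartDiam (distr M borel f) m)
       \<le> PartDiam (distr M (restrict_space borel {- (R / m) .. R / m}) g) m"
proof -
  interpret mm_space M by fact
  let ?Y = "{- (R / m) .. R / m}"
  have meas: "f \<in> borel_measurable M"
    using lipschitz_on_continuous_on[OF f] sets_eq_borel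
    by (metis borel_measurable_continuous_onI measurable_cong_sets)
  define N where "N = distr M borel f"
  interpret N: real_distribution N
    unfolding N_def by (rule real_distribution_distr) (rule meas)
  obtain S where S: "finite S" "card S * m \<le> 1"
    and pierce: "\<And>B. B \<in> sets borel \<Longrightarrow> m \<le> measure N B \<Longrightarrow>
       \<exists>q\<in>S. (\<exists>b\<in>B. b \<le> q) \<and> (\<forall>z<q. \<exists>b\<in>B. z < b)"
    using N.piercing_points[of m] assms by metis
  obtain h where h_bound: "\<And>x. \<bar>h x\<bar> \<le> card S * R"
    and h_lip: "1-lipschitz_on UNIV h"
    and h_slope: "\<And>q u v. q \<in> S \<Longrightarrow> u \<le> v \<Longrightarrow> min v (q + R) - max u (q - R) \<le> h v - h u"
    using slope_one_near_points[OF S(1) \<open>0 < R\<close>] by metis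
  have h_meas[measurable]: "h \<in> borel_measurable borel"
    using lipschitz_on_continuous_on[OF h_lip] by (rule borel_measurable_continuous_onI)
  have "card S * R \<le> R / m"
    using mult_right_mono[OF S(2), of R] assms by (simp add: field_simps)
  then have h_range: "h x \<in> ?Y" for x
    using h_bound[of x] by auto
  show thesis
  proof
    have "1-lipschitz_on UNIV (h \<circ> f)"
      using lipschitz_on_compose[OF f lipschitz_on_subset[OF h_lip]] by simp
    then show "h \<circ> f \<in> Lip1 UNIV ?Y"
      using h_range by (auto simp: Lip1_def)
    have gm: "h \<circ> f \<in> measurable M (restrict_space borel ?Y)"
      using meas h_range by (intro measurable_restrict_space2) auto
    show "min (ennreal R) (PartDiam (distr M borel f) m)
       \<le> PartDiam (distr M (restrict_space borel ?Y) (h \<circ> f)) m"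
      unfolding PartDiam_def[of "distr M (restrict_space borel ?Y) (h \<circ> f)"]
    proof (rule INF_greatest)
      fix A assume "A \<in> {A \<in> sets (distr M (restrict_space borel ?Y) (h \<circ> f)).
            m \<le> measure (distr M (restrict_space borel ?Y) (h \<circ> f)) A}"
      then have A: "A \<in> sets (restrict_space borel ?Y)"
        and mA: "m \<le> measure (distr M (restrict_space borel ?Y) (h \<circ> f)) A" by auto
      have Ab[measurable]: "A \<in> sets borel"
        using A by (auto simp: sets_restrict_space_iff)
      define B where "B = h -` A"
      have B: "B \<in> sets borel"
        using measurable_sets[OF h_meas Ab] by (simp add: B_def)
      have "measure (distr M (restrict_space borel ?Y) (h \<circ> f)) A = measure N B"
        using A gm meas B by (simp add: N_def measure_distr B_def vimage_comp)
      then have mB: "m \<le> measure N B" using mA by simp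
      obtain q where q: "q \<in> S" and low: "\<exists>b\<in>B. b \<le> q" and up: "\<And>z. z < q \<Longrightarrow> \<exists>b\<in>B. z < b"
        using pierce[OF B mB] by blast
      have "PartDiam N m \<le> ediam B"
        unfolding PartDiam_def using B mB by (intro INF_lower) auto
      then have *: "min (ennreal R) (PartDiam (distr M borel f) m) \<le> min (ennreal R) (ediam B)"
        unfolding N_def by (auto simp: min.coboundedI2)
      have "min (ennreal R) (ediam B) \<le> ediam A"
      proof (rule dense_le)
        fix s assume "s < min (ennreal R) (ediam B)"
        then have s: "s < ennreal R" "s < ediam B" by auto
        then obtain r where r: "s = ennreal r" "0 \<le> r" "r < R"
          by (cases s) (auto simp: ennreal_less_iff)
        obtain x y where "x \<in> B" "y \<in> B" "s < ennreal (dist x y)"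
          using s(2) by (auto simp: ediam_def less_SUP_iff)
        then obtain u0 v0 where uv0: "u0 \<in> B" "v0 \<in> B" "u0 + r < v0"
          using r by (cases "x \<le> y") (force simp: ennreal_less_iff dist_real_def)+
        obtain u1 where u1: "u1 \<in> B" "u1 \<le> q" using low by blast
        \<comment> \<open>No point of \<open>B\<close> need lie to the right of \<open>q\<close>; falling short of \<open>q\<close> by less than
          \<open>R - r\<close> leaves more than \<open>r\<close> of the slope-one stretch \<open>[q - R, q]\<close>.\<close>
        obtain v1 where v1: "v1 \<in> B" "q - (R - r) < v1" using up[of "q - (R - r)"] r by auto
        define u where "u = min u0 u1"
        define v where "v = max v0 v1"
        have uv: "u \<in> B" "v \<in> B" "u \<le> q" "q - (R - r) < v" "u + r < v"
          using uv0 u1 v1 by (auto simp: u_def v_def min_def max_def)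
        have "r < min v (q + R) - max u (q - R)"
          using uv r assms by auto
        also have "\<dots> \<le> h v - h u"
          using uv r by (intro h_slope q) auto
        also have "\<dots> \<le> dist (h v) (h u)" by (simp add: dist_real_def)
        finally have "s \<le> ennreal (dist (h v) (h u))"
          using r by (simp add: ennreal_leI)
        also have "\<dots> \<le> ediam A"
          unfolding ediam_def using uv
          by (intro SUP_upper2[of "h v"] SUP_upper2[of "h u"]) (auto simp: B_def)
        finally show "s \<le> ediam A" .
      qed
      with * show "min (ennreal R) (PartDiam (distr M borel f) m) \<le> ediam A"
        by (rule order_trans)
    qed
  qed
qed

theorem mainTheorem4:
  fixes M :: "'a::polish_space measure" and \<kappa> R :: real
  assumes "mm_space M"
    and "0 < \<kappa>" and "\<kappa> < 1" and "0 < R"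
  shows "min (ennreal R) (ObsDiam M \<kappa>)
           \<le> ObsDiam_screen M {- (R / (1 - \<kappa>)) .. R / (1 - \<kappa>)} \<kappa>"
proof (rule ccontr)
  let ?m = "1 - \<kappa>" and ?O = "ObsDiam_screen M {- (R / (1 - \<kappa>)) .. R / (1 - \<kappa>)} \<kappa>"
  assume "\<not> ?thesis"
  then have "?O < ennreal R" "?O < ObsDiam M \<kappa>" by (auto simp: not_le)
  then obtain f :: "'a \<Rightarrow> real" where "1-lipschitz_on UNIV f"
    and f: "?O < PartDiam (distr M borel f) ?m"
    unfolding ObsDiam_def ObsDiam_screen_def[of M UNIV] less_SUP_iff
    by (auto simp: Lip1_def sets_restrict_UNIV cong: distr_cong)
  then obtain g where "g \<in> Lip1 UNIV {- (R / ?m) .. R / ?m}"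
    "min (ennreal R) (PartDiam (distr M borel f) ?m)
       \<le> PartDiam (distr M (restrict_space borel {- (R / ?m) .. R / ?m}) g) ?m"
    using PartDiam_screen_ge[of M ?m R f] assms by auto
  then have "min (ennreal R) (PartDiam (distr M borel f) ?m) \<le> ?O"
    unfolding ObsDiam_screen_def by (auto intro: SUP_upper2)
  with \<open>?O < ennreal R\<close> f show False by (metis min_le_iff_disj not_le)
qed

end
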